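(* Let $N \ge 2$ be an integer and let $X_1, \ldots, X_N$ be independent and identically distributed real random variables with mean $\mu$ and finite variance $\sigma^2$. Let $c_1, \ldots, c_N$ be real numbers satisfying $\sum_{n=1}^N c_n = 1$ and $\sum_{n=1}^N c_n^2 = \frac{2}{N}$, and put $\hat{X} = \sum_{n=1}^N c_n X_n$ and $\bar{X} = \frac{1}{N} \sum_{n=1}^N X_n$. For real $\lambda$ define $$\tilde{X}_\lambda = \lambda \hat{X} + (1 - \lambda) \bar{X}, \qquad s_\lambda^2 = \frac{1}{N - 1 + \lambda^2} \sum_{n=1}^N (X_n - \tilde{X}_\lambda)^2.$$ Then for every real $\lambda$, $\mathbb{E}[s_\lambda^2] = \sigma^2$, i.e. $s_\lambda^2$ is an unbiased estimator of the variance. In particular, for every real $K \ge N-1$, taking $\lambda = \sqrt{K - N + 1}$ gives an unbiased variance estimator $\frac{1}{K} \sum_{n=1}^N (X_n - \tilde{X}_\lambda)^2$ with denominator $K$.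
   Context: All random variables are real-valued and defined on a common probability space; $\mathbb{E}$ denotes expectation. *)

theory Defs
  imports "HOL-Probability.Probability"
begin

(* Samples are families X :: nat => 'a => real indexed by {1..N}; a statistic is the random
   variable obtained by evaluating all sample members at the same outcome w. *)

definition iid_sample :: "'a measure \<Rightarrow> nat \<Rightarrow> (nat \<Rightarrow> 'a \<Rightarrow> real) \<Rightarrow> bool" where
  "iid_sample M N X \<longleftrightarrow>
     prob_space.indep_vars M (\<lambda>_. borel) X {1..N} \<and>
     (\<forall>m\<in>{1..N}. \<forall>n\<in>{1..N}. distr M borel (X m) = distr M borel (X n))"

definition weighted_mean :: "nat \<Rightarrow> (nat \<Rightarrow> real) \<Rightarrow> (nat \<Rightarrow> 'a \<Rightarrow> real) \<Rightarrow> 'a \<Rightarrow> real" where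
  "weighted_mean N c X w = (\<Sum>n=1..N. c n * X n w)"

definition sample_mean :: "nat \<Rightarrow> (nat \<Rightarrow> 'a \<Rightarrow> real) \<Rightarrow> 'a \<Rightarrow> real" where
  "sample_mean N X w = 1 / real N * (\<Sum>n=1..N. X n w)"

definition mixed_mean ::
  "nat \<Rightarrow> (nat \<Rightarrow> real) \<Rightarrow> (nat \<Rightarrow> 'a \<Rightarrow> real) \<Rightarrow> real \<Rightarrow> 'a \<Rightarrow> real" where
  "mixed_mean N c X lam w = lam * weighted_mean N c X w + (1 - lam) * sample_mean N X w"

(* This is the estimator s_lambda^2 itself, not its square root. *)
definition s_sq ::
  "nat \<Rightarrow> (nat \<Rightarrow> real) \<Rightarrow> (nat \<Rightarrow> 'a \<Rightarrow> real) \<Rightarrow> real \<Rightarrow> 'a \<Rightarrow> real" where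
  "s_sq N c X lam w =
     1 / (real N - 1 + lam\<^sup>2) * (\<Sum>n=1..N. (X n w - mixed_mean N c X lam w)\<^sup>2)"

(* Integrability is required because the Bochner integral of a non-integrable function is 0. *)
definition has_expectation :: "'a measure \<Rightarrow> ('a \<Rightarrow> real) \<Rightarrow> real \<Rightarrow> bool" where
  "has_expectation M Y y \<longleftrightarrow> integrable M Y \<and> integral\<^sup>L M Y = y"

end

(* A mixed mean is a linear combination of the sample with weights a n = lam * c n + (1 - lam) / N,
   whose sum is 1 and whose sum of squares is (1 + lam^2) / N. The centred sample is orthogonal
   with common second moment sigma^2, so each deviation X n - (SUM m. a m * X m) has second moment
   sigma^2 * (1 - 2 * a n + (SUM m. (a m)^2)); summing over n gives sigma^2 * (N - 1 + lam^2). *)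
theory Submission
  imports Defs
begin

lemma has_expectation_sum:
  assumes "\<And>i. i \<in> I \<Longrightarrow> has_expectation M (Y i) (y i)"
  shows "has_expectation M (\<lambda>w. \<Sum>i\<in>I. Y i w) (\<Sum>i\<in>I. y i)"
  using assms by (simp add: has_expectation_def)

lemma has_expectation_cmult:
  assumes "has_expectation M Y y"
  shows "has_expectation M (\<lambda>w. r * Y w) (r * y)"
  using assms by (simp add: has_expectation_def)

lemma (in prob_space) has_expectation_indep_mult:
  assumes "indep_var borel Y borel Z" "has_expectation M Y y" "has_expectation M Z z"
  shows "has_expectation M (\<lambda>w. Y w * Z w) (y * z)"
  using assms indep_var_lebesgue_integral[of Y Z] indep_var_integrable[of Y Z]
  by (simp add: has_expectation_def)

text \<open>Expanding the square gives a double sum over pairs, of which only the diagonal survives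
  in expectation. Integrability of every product is part of the assumption, so it passes to the
  square.\<close>

lemma has_expectation_orthogonal_square:
  fixes Y :: "'i \<Rightarrow> 'a \<Rightarrow> real"
  assumes "finite I"
    and "\<And>i j. i \<in> I \<Longrightarrow> j \<in> I \<Longrightarrow> has_expectation M (\<lambda>w. Y i w * Y j w) (if i = j then v else 0)"
  shows "has_expectation M (\<lambda>w. (\<Sum>i\<in>I. p i * Y i w)\<^sup>2) (v * (\<Sum>i\<in>I. (p i)\<^sup>2))"
proof -
  have "has_expectation M (\<lambda>w. \<Sum>i\<in>I. \<Sum>j\<in>I. (p i * p j) * (Y i w * Y j w))
          (\<Sum>i\<in>I. \<Sum>j\<in>I. (p i * p j) * (if i = j then v else 0))"
    by (intro has_expectation_sum has_expectation_cmult assms(2))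
  moreover have "(\<Sum>i\<in>I. \<Sum>j\<in>I. (p i * p j) * (if i = j then v else 0)) = v * (\<Sum>i\<in>I. (p i)\<^sup>2)"
    using assms(1) by (simp add: if_distrib[of "(*) _"] sum.delta' sum_distrib_left power2_eq_square
        mult_ac cong: if_cong)
  ultimately show ?thesis
    by (simp add: power2_eq_square sum_product mult_ac)
qed

text \<open>On the diagonal this is the variance. Off the diagonal the centred variables are
  independent, so their product is integrable with expectation 0 * 0.\<close>

lemma (in prob_space) has_expectation_centred_products:
  fixes X :: "'i \<Rightarrow> 'a \<Rightarrow> real"
  assumes indep: "indep_vars (\<lambda>_. borel) X I"
    and mean: "\<And>i. i \<in> I \<Longrightarrow> has_expectation M (X i) \<mu>"
    and var: "\<And>i. i \<in> I \<Longrightarrow> has_expectation M (\<lambda>w. (X i w - \<mu>)\<^sup>2) v"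
    and ij: "i \<in> I" "j \<in> I"
  shows "has_expectation M (\<lambda>w. (X i w - \<mu>) * (X j w - \<mu>)) (if i = j then v else 0)"
proof (cases "i = j")
  case True
  then show ?thesis using var[OF ij(1)] by (simp add: power2_eq_square)
next
  case False
  have centred: "has_expectation M (\<lambda>w. X k w - \<mu>) 0" if "k \<in> I" for k
    using mean[OF that] by (simp add: has_expectation_def prob_space)
  have "indep_vars (\<lambda>_. borel) (\<lambda>k w. X k w - \<mu>) I"
    using indep_vars_compose2[OF indep, of "\<lambda>_ x. x - \<mu>" "\<lambda>_. borel"] by simp
  then have "indep_vars (\<lambda>_. borel) (\<lambda>k w. X k w - \<mu>) {i, j}"
    by (rule indep_vars_subset) (use ij in simp)
  \<comment> \<open>A sum over the singleton \<open>{j}\<close> turns independence of the family on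
    \<open>{i, j}\<close> into independence of two variables.\<close>
  then have "indep_var borel (\<lambda>w. X i w - \<mu>) borel (\<lambda>w. X j w - \<mu>)"
    using indep_vars_sum[of "{j}" i "\<lambda>k w. X k w - \<mu>"] False by simp
  from has_expectation_indep_mult[OF this centred centred] show ?thesis
    using False ij by simp
qed

text \<open>Each deviation is a linear combination of the centred, mutually orthogonal variables, so
  its second moment is \<open>v\<close> times the squared norm of its coefficient vector.\<close>

lemma (in prob_space) has_expectation_sum_sq_deviation:
  fixes X :: "'i \<Rightarrow> 'a \<Rightarrow> real"
  assumes fin: "finite I"
    and indep: "indep_vars (\<lambda>_. borel) X I"
    and mean: "\<And>i. i \<in> I \<Longrightarrow> has_expectation M (X i) \<mu>"
    and var: "\<And>i. i \<in> I \<Longrightarrow> has_expectation M (\<lambda>w. (X i w - \<mu>)\<^sup>2) v"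
    and a: "(\<Sum>i\<in>I. a i) = 1"
  shows "has_expectation M (\<lambda>w. \<Sum>n\<in>I. (X n w - (\<Sum>i\<in>I. a i * X i w))\<^sup>2)
           (v * (real (card I) - 2 + real (card I) * (\<Sum>i\<in>I. (a i)\<^sup>2)))"
proof -
  \<comment> \<open>Coefficients of the \<open>n\<close>-th deviation: the \<open>n\<close>-th unit
    vector minus the weight vector \<open>a\<close>.\<close>
  define p where "p n i = (if i = n then 1 else 0) - a i" for n i
  have deviation: "X n w - (\<Sum>i\<in>I. a i * X i w) = (\<Sum>i\<in>I. p n i * (X i w - \<mu>))" if "n \<in> I" for n w
  proof -
    have "(\<Sum>i\<in>I. p n i * (X i w - \<mu>))
        = (\<Sum>i\<in>I. if i = n then X i w - \<mu> else 0) - (\<Sum>i\<in>I. a i * X i w) + (\<Sum>i\<in>I. a i) * \<mu>"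
      unfolding sum_distrib_right sum_subtractf[symmetric] sum.distrib[symmetric]
      by (intro sum.cong) (auto simp: p_def algebra_simps)
    \<comment> \<open>The weights sum to 1, so the \<mu> subtracted from \<open>X n w\<close>
      cancels against the \<mu> coming from the weighted sum.\<close>
    then show ?thesis using fin that a by simp
  qed
  have norm_p: "(\<Sum>i\<in>I. (p n i)\<^sup>2) = 1 - 2 * a n + (\<Sum>i\<in>I. (a i)\<^sup>2)" if "n \<in> I" for n
  proof -
    have "(\<Sum>i\<in>I. (p n i)\<^sup>2) = (\<Sum>i\<in>I. if i = n then 1 - 2 * a i else 0) + (\<Sum>i\<in>I. (a i)\<^sup>2)"
      unfolding sum.distrib[symmetric]
      by (intro sum.cong) (auto simp: p_def power2_eq_square algebra_simps)
    then show ?thesis using fin that by simp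
  qed
  have "has_expectation M (\<lambda>w. \<Sum>n\<in>I. (\<Sum>i\<in>I. p n i * (X i w - \<mu>))\<^sup>2)
          (\<Sum>n\<in>I. v * (\<Sum>i\<in>I. (p n i)\<^sup>2))"
    by (intro has_expectation_sum has_expectation_orthogonal_square fin
        has_expectation_centred_products[OF indep mean var])
  \<comment> \<open>Summing the squared norms over \<open>n\<close> turns the terms
    \<open>2 * a n\<close> into the constant 2.\<close>
  moreover have "(\<Sum>n\<in>I. v * (\<Sum>i\<in>I. (p n i)\<^sup>2))
      = v * (real (card I) - 2 + real (card I) * (\<Sum>i\<in>I. (a i)\<^sup>2))"
    by (simp add: norm_p sum.distrib sum_subtractf a flip: sum_distrib_left)
  ultimately show ?thesis by (simp add: deviation)
qed

theorem mainTheorem3: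
  fixes M :: "'a measure" and N :: nat
    and X :: "nat \<Rightarrow> 'a \<Rightarrow> real" and c :: "nat \<Rightarrow> real" and \<mu> \<sigma> :: real
  assumes "prob_space M"
    and "N \<ge> 2"
    and "iid_sample M N X"
    and "\<And>n. n \<in> {1..N} \<Longrightarrow> has_expectation M (X n) \<mu>"
    and "\<And>n. n \<in> {1..N} \<Longrightarrow> has_expectation M (\<lambda>w. (X n w - \<mu>)\<^sup>2) (\<sigma>\<^sup>2)"
    and "(\<Sum>n=1..N. c n) = 1"
    and "(\<Sum>n=1..N. (c n)\<^sup>2) = 2 / real N"
  shows "(\<forall>lam::real. has_expectation M (s_sq N c X lam) (\<sigma>\<^sup>2)) \<and>
         (\<forall>K::real. K \<ge> real N - 1 \<longrightarrow>
            has_expectation M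
              (\<lambda>w. 1 / K * (\<Sum>n=1..N. (X n w - mixed_mean N c X (sqrt (K - real N + 1)) w)\<^sup>2))
              (\<sigma>\<^sup>2))"
proof -
  interpret prob_space M by fact
  have N: "real N \<ge> 2" using assms(2) by simp
  have unbiased: "has_expectation M (s_sq N c X lam) (\<sigma>\<^sup>2)" for lam
  proof -
    define a where "a n = lam * c n + (1 - lam) / real N" for n
    have mixed: "mixed_mean N c X lam w = (\<Sum>n=1..N. a n * X n w)" for w
      by (simp add: mixed_mean_def weighted_mean_def sample_mean_def a_def distrib_right
          sum.distrib mult.assoc flip: sum_distrib_left sum_divide_distrib)
    have sum_a: "(\<Sum>n=1..N. a n) = 1"
      using N assms(6) by (simp add: a_def sum.distrib flip: sum_distrib_left)
    have "(a n)\<^sup>2 = lam\<^sup>2 * (c n)\<^sup>2 + 2 * lam * (1 - lam) / real N * c n + ((1 - lam) / real N)\<^sup>2" for n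
      by (simp add: a_def power2_sum power_mult_distrib)
    then have "(\<Sum>n=1..N. (a n)\<^sup>2) = lam\<^sup>2 * (\<Sum>n=1..N. (c n)\<^sup>2)
        + 2 * lam * (1 - lam) / real N * (\<Sum>n=1..N. c n) + real N * ((1 - lam) / real N)\<^sup>2"
      by (simp only: sum.distrib sum_distrib_left[symmetric]) simp
    \<comment> \<open>Multiplied by \<open>real N\<close>, the three terms are 2 lam^2 + 2 lam (1 -
      lam) + (1 - lam)^2 = 1 + lam^2; the 2 in the first is the prescribed norm of
      \<open>c\<close>.\<close>
    also have "\<dots> = (1 + lam\<^sup>2) / real N"
      using N unfolding assms(6,7) by (simp add: field_simps power2_eq_square)
    finally have norm_a: "real N * (\<Sum>n=1..N. (a n)\<^sup>2) = 1 + lam\<^sup>2"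
      using N by simp
    have "has_expectation M (\<lambda>w. \<Sum>n=1..N. (X n w - mixed_mean N c X lam w)\<^sup>2)
        (\<sigma>\<^sup>2 * (real N - 1 + lam\<^sup>2))"
      using has_expectation_sum_sq_deviation[of "{1..N}" X, OF _ _ assms(4,5) sum_a] assms(3)
      by (simp add: mixed iid_sample_def norm_a[simplified] add_diff_eq diff_add_eq)
    from has_expectation_cmult[OF this, of "1 / (real N - 1 + lam\<^sup>2)"]
    show ?thesis
      \<comment> \<open>As N \<ge> 2, the denominator is positive for every \<open>lam\<close> and
        cancels.\<close>
      using N add_pos_nonneg[of "real N - 1" "lam\<^sup>2"] by (simp add: s_sq_def[abs_def])
  qed
  \<comment> \<open>The bound on \<open>K\<close> makes the radicand nonnegative, so the squared
    root is \<open>K - real N + 1\<close> and the denominator of \<open>s_sq\<close> becomes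
    \<open>K\<close>.\<close>
  moreover have "(\<lambda>w. 1 / K * (\<Sum>n=1..N. (X n w - mixed_mean N c X (sqrt (K - real N + 1)) w)\<^sup>2))
      = s_sq N c X (sqrt (K - real N + 1))" if "K \<ge> real N - 1" for K
    using that by (simp add: s_sq_def[abs_def])
  ultimately show ?thesis by simp
qed

end
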